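(* Let $X_0$, $\hat X$ and $Y$ be Hilbert spaces over $\mathbb{C}$, let $Y_0$ be a closed subspace of $Y$, and let $b_0:X_0\times Y\to\mathbb{C}$ and $\hat b:\hat X\times Y\to\mathbb{C}$ be continuous sesquilinear forms. Let $X=X_0\times\hat X$ with the Cartesian product norm $\|(x,\hat x)\|_X^2=\|x\|_{X_0}^2+\|\hat x\|_{\hat X}^2$ and set $b((x,\hat x),y)=b_0(x,y)+\hat b(\hat x,y)$. Assume: (1) there is $c_0>0$ such that $c_0\|x\|_{X_0}\le\sup_{y\in Y_0}\frac{|b_0(x,y)|}{\|y\|_Y}$ for all $x\in X_0$; (2) $Y_0=\{y\in Y:\hat b(\hat x,y)=0\text{ for all }\hat x\in\hat X\}$, and there is $\hat c>0$ such that $\hat c\,\|\hat x\|_{\hat X}\le\sup_{y\in Y}\frac{|\hat b(\hat x,y)|}{\|y\|_Y}$ for all $\hat x\in\hat X$. Then for all $(x,\hat x)\in X$, $$c_1\|(x,\hat x)\|_X\le\sup_{y\in Y}\frac{|b((x,\hat x),y)|}{\|y\|_Y},\qquad\text{where}\quad \frac1{c_1^2}=\frac1{c_0^2}+\frac1{\hat c^2}\left(\frac{\|b_0\|}{c_0}+1\right)^2 .$$ Moreover, with $Z_0=\{y\in Y_0:b_0(x,y)=0\text{ for all }x\in X_0\}$ and $Z=\{y\in Y:b((x,\hat x),y)=0\text{ for all }x\in X_0,\ \hat x\in\hat X\}$, one has $Z=Z_0$. Consequently, if $Z_0=\{0\}$, then for every $\ell\in Y'$ the problem of finding $(x,\hat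 x)\in X$ such that $b((x,\hat x),y)=\ell(y)$ for all $y\in Y$ is uniquely solvable, and moreover its solution component $x$ coincides with the solution $x\in X_0$ of $b_0(x,y)=\ell(y)$ for all $y\in Y_0$.
   Context: $Y'$ is the space of continuous conjugate linear functionals on $Y$. $\|b_0\|$ is the smallest number $C$ such that $|b_0(x,y)|\le C\|x\|_{X_0}\|y\|_Y$ for all $x\in X_0$, $y\in Y$. Suprema over vector spaces omit the zero element. $Y_0$ carries the norm of $Y$. *)

theory Defs
  imports "HOL-Analysis.Analysis"
begin

text \<open>The inner product is linear in its first argument. The axiom \<open>cinner_self\<close> says both that
  the inner product is positive definite and that the norm is the one it induces. The zero space
  is allowed.\<close>

class complex_hilbert = banach +
  fixes scaleC :: "complex \<Rightarrow> 'a \<Rightarrow> 'a"  (infixr \<open>*\<^sub>C\<close> 75)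
    and cinner :: "'a \<Rightarrow> 'a \<Rightarrow> complex"
  assumes scaleC_add_right: "a *\<^sub>C (x + y) = a *\<^sub>C x + a *\<^sub>C y"
    and scaleC_add_left: "(a + b) *\<^sub>C x = a *\<^sub>C x + b *\<^sub>C x"
    and scaleC_scaleC: "a *\<^sub>C b *\<^sub>C x = (a * b) *\<^sub>C x"
    and scaleR_scaleC: "scaleR r x = complex_of_real r *\<^sub>C x"
    and cinner_add_left: "cinner (x + y) z = cinner x z + cinner y z"
    and cinner_scaleC_left: "cinner (a *\<^sub>C x) y = a * cinner x y"
    and cinner_commute: "cinner x y = cnj (cinner y x)"
    and cinner_self: "cinner x x = complex_of_real ((norm x)\<^sup>2)"

lemma scaleC_one [simp]: "1 *\<^sub>C x = (x :: 'a :: complex_hilbert)"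
  using scaleR_scaleC[of 1 x] by simp

global_interpretation complex_vector:
  vector_space "scaleC :: complex \<Rightarrow> 'a \<Rightarrow> 'a :: complex_hilbert"
  by unfold_locales (simp_all add: scaleC_add_right scaleC_add_left scaleC_scaleC)

instantiation complex :: complex_hilbert
begin

definition scaleC_complex :: "complex \<Rightarrow> complex \<Rightarrow> complex"
  where "scaleC_complex a x = a * x"

definition cinner_complex :: "complex \<Rightarrow> complex \<Rightarrow> complex"
  where "cinner_complex x y = x * cnj y"

instance
proof
  fix x :: complex
  show "cinner x x = complex_of_real ((norm x)\<^sup>2)"
    unfolding cinner_complex_def by (rule complex_norm_square [symmetric])
qed (simp_all add: scaleC_complex_def cinner_complex_def ring_distribs scaleR_conv_of_real)

end

text \<open>The norm that the library puts on a product type is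
  \<open>sqrt ((norm x)\<^sup>2 + (norm xh)\<^sup>2)\<close>, that is, the Cartesian product norm
  (\<open>norm_prod_def\<close>).\<close>

instantiation prod :: (complex_hilbert, complex_hilbert) complex_hilbert
begin

definition scaleC_prod :: "complex \<Rightarrow> 'a \<times> 'b \<Rightarrow> 'a \<times> 'b"
  where "scaleC_prod a p = (a *\<^sub>C fst p, a *\<^sub>C snd p)"

definition cinner_prod :: "'a \<times> 'b \<Rightarrow> 'a \<times> 'b \<Rightarrow> complex"
  where "cinner_prod p q = cinner (fst p) (fst q) + cinner (snd p) (snd q)"

instance
proof
  fix p q r :: "'a \<times> 'b" and a c :: complex and t :: real
  show "a *\<^sub>C (p + q) = a *\<^sub>C p + a *\<^sub>C q"
    by (simp add: scaleC_prod_def scaleC_add_right)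
  show "(a + c) *\<^sub>C p = a *\<^sub>C p + c *\<^sub>C p"
    by (simp add: scaleC_prod_def scaleC_add_left)
  show "a *\<^sub>C c *\<^sub>C p = (a * c) *\<^sub>C p"
    by (simp add: scaleC_prod_def scaleC_scaleC)
  show "t *\<^sub>R p = complex_of_real t *\<^sub>C p"
    by (simp add: scaleC_prod_def scaleR_prod_def scaleR_scaleC)
  show "cinner (p + q) r = cinner p r + cinner q r"
    by (simp add: cinner_prod_def cinner_add_left)
  show "cinner (a *\<^sub>C p) q = a * cinner p q"
    by (simp add: cinner_prod_def scaleC_prod_def cinner_scaleC_left distrib_left)
  show "cinner p q = cnj (cinner q p)"
    unfolding cinner_prod_def complex_cnj_add by (intro arg_cong2[where f = "(+)"] cinner_commute)
  show "cinner p p = complex_of_real ((norm p)\<^sup>2)"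
    by (simp add: cinner_prod_def cinner_self norm_prod_def)
qed

end

definition sesquilinear :: "('a :: complex_hilbert \<Rightarrow> 'b :: complex_hilbert \<Rightarrow> complex) \<Rightarrow> bool"
  where "sesquilinear b \<longleftrightarrow>
    (\<forall>x x' y. b (x + x') y = b x y + b x' y) \<and>
    (\<forall>c x y. b (c *\<^sub>C x) y = c * b x y) \<and>
    (\<forall>x y y'. b x (y + y') = b x y + b x y') \<and>
    (\<forall>c x y. b x (c *\<^sub>C y) = cnj c * b x y)"

definition continuous_sesquilinear ::
    "('a :: complex_hilbert \<Rightarrow> 'b :: complex_hilbert \<Rightarrow> complex) \<Rightarrow> bool"
  where "continuous_sesquilinear b \<longleftrightarrow>
    sesquilinear b \<and> continuous_on UNIV (\<lambda>(x, y). b x y)"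

text \<open>The condition \<open>0 \<le> C\<close> matters only if one of the two spaces is zero; otherwise it is implied.\<close>

definition form_norm :: "('a :: complex_hilbert \<Rightarrow> 'b :: complex_hilbert \<Rightarrow> complex) \<Rightarrow> real"
  where "form_norm b = (LEAST C. 0 \<le> C \<and> (\<forall>x y. cmod (b x y) \<le> C * norm x * norm y))"

definition antidual :: "('a :: complex_hilbert \<Rightarrow> complex) set"
  where "antidual = {l. (\<forall>y y'. l (y + y') = l y + l y') \<and>
    (\<forall>c y. l (c *\<^sub>C y) = cnj c * l y) \<and> continuous_on UNIV l}"

text \<open>The supremum of \<open>|l y| / norm y\<close> over the nonzero elements of \<open>S\<close>, taken in \<open>[0, \<infinity>]\<close>: it is
  \<open>0\<close> if \<open>S\<close> is the zero space.\<close>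

definition sup_quotient :: "('a :: complex_hilbert \<Rightarrow> complex) \<Rightarrow> 'a set \<Rightarrow> ennreal"
  where "sup_quotient l S = (SUP y \<in> S - {0}. ennreal (cmod (l y) / norm y))"

definition product_form :: "('a \<Rightarrow> 'c \<Rightarrow> complex) \<Rightarrow> ('b \<Rightarrow> 'c \<Rightarrow> complex) \<Rightarrow> 'a \<times> 'b \<Rightarrow> 'c \<Rightarrow> complex"
  where "product_form b0 bh = (\<lambda>(x, xh) y. b0 x y + bh xh y)"

end

theory Submission
  imports Defs
begin

text \<open>
  The inf-sup bound is obtained in two steps. Let \<open>M\<close> bound \<open>|b (x, xh) y| / norm y\<close>. On \<open>Y0\<close> the
  form \<open>bh\<close> vanishes, so testing there shows \<open>c0 * norm x \<le> M\<close>. Testing on all of \<open>Y\<close> and moving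
  \<open>b0 x y\<close> to the other side shows
  \<open>ch * norm xh \<le> M + form_norm b0 * norm x \<le> M * (1 + form_norm b0 / c0)\<close>.
  Adding squares gives the constant \<open>c1\<close>.

  Solvability is then an instance of the general theorem \<open>inf_sup_wellposed\<close>: a bounded form that
  satisfies an inf-sup condition and is nondegenerate in its second argument represents every
  antilinear functional exactly once. Its proof rests on one variational principle,
  \<open>normal_equation_solvable\<close>: if \<open>T\<close> is bounded and bounded below, the quadratic functional
  \<open>\<parallel>T x\<parallel>\<^sup>2 - 2 Re (l x)\<close> has a minimizer, which solves \<open>\<langle>T x, T z\<rangle> = l z\<close>. With \<open>T\<close> the identity this
  is the Riesz representation theorem, which yields a vector \<open>u\<close> for \<open>l\<close> and an operator \<open>B\<close> for \<open>b\<close>.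
  With \<open>T = B\<close> it yields \<open>x\<close> such that \<open>u - B x\<close> is orthogonal to the range of \<open>B\<close>, and
  nondegeneracy says that such a vector is zero.

  The reduced problem on \<open>Y0\<close> needs no existence proof of its own: the first component of a solution
  on \<open>Y\<close> solves it, because \<open>bh\<close> vanishes on \<open>Y0\<close>, and the inf-sup condition for \<open>b0\<close> makes its
  solution unique.
\<close>

section \<open>Inf-sup conditions and bounds of forms\<close>

text \<open>Replacing the extended supremum by its real upper bounds keeps \<open>ennreal\<close> out of the
  estimates. If the supremum is infinite the right-hand side holds vacuously.\<close>

lemma le_sup_quotient_iff:
  assumes "l 0 = 0"
  shows "ennreal a \<le> sup_quotient l S \<longleftrightarrow>
    (\<forall>M\<ge>0. (\<forall>y\<in>S. cmod (l y) \<le> M * norm y) \<longrightarrow> a \<le> M)"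
proof (intro iffI allI impI)
  fix M :: real
  assume a: "ennreal a \<le> sup_quotient l S" and M: "0 \<le> M"
    and bound: "\<forall>y\<in>S. cmod (l y) \<le> M * norm y"
  have "sup_quotient l S \<le> ennreal M"
    unfolding sup_quotient_def
    using bound by (intro SUP_least ennreal_leI) (auto simp: divide_le_eq)
  with a have "ennreal a \<le> ennreal M" by (rule order_trans)
  with M show "a \<le> M" by simp
next
  assume *: "\<forall>M\<ge>0. (\<forall>y\<in>S. cmod (l y) \<le> M * norm y) \<longrightarrow> a \<le> M"
  show "ennreal a \<le> sup_quotient l S"
  proof (cases "sup_quotient l S")
    case (real M)
    have "cmod (l y) \<le> M * norm y" if "y \<in> S" for y
    proof (cases "y = 0")
      case False
      with that have "ennreal (cmod (l y) / norm y) \<le> sup_quotient l S"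
        unfolding sup_quotient_def by (intro SUP_upper) auto
      with real have "cmod (l y) / norm y \<le> M" by simp
      with False show ?thesis by (simp add: divide_le_eq)
    qed (simp add: assms)
    with * real show ?thesis by (simp add: ennreal_leI)
  qed simp
qed

lemma sesquilinearD:
  assumes "sesquilinear b"
  shows sesquilinear_add_left: "b (x + x') y = b x y + b x' y"
    and sesquilinear_scaleC_left: "b (c *\<^sub>C x) y = c * b x y"
    and sesquilinear_add_right: "b x (y + y') = b x y + b x y'"
    and sesquilinear_scaleC_right: "b x (c *\<^sub>C y) = cnj c * b x y"
  using assms unfolding sesquilinear_def by blast+

lemma sesquilinear_diff_left:
  assumes "sesquilinear b"
  shows "b (x - x') y = b x y - b x' y"
  using sesquilinear_add_left[OF assms, of "x - x'" x' y] by simp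

lemma sesquilinear_zero_left: "sesquilinear b \<Longrightarrow> b 0 y = 0"
  using sesquilinear_diff_left[of b 0 0] by simp

lemma sesquilinear_zero_right: "sesquilinear b \<Longrightarrow> b x 0 = 0"
  using sesquilinear_add_right[of b x 0 0] by simp

lemma sesquilinear_scaleR:
  assumes "sesquilinear b"
  shows "b (r *\<^sub>R x) (s *\<^sub>R y) = of_real (r * s) * b x y"
  by (simp add: scaleR_scaleC sesquilinear_scaleC_left[OF assms]
      sesquilinear_scaleC_right[OF assms])

text \<open>Continuity at the origin bounds the form on a small ball; real homogeneity in each argument
  extends the bound by scaling both arguments to norm \<open>d / 3\<close>, which keeps the pair inside the
  ball.\<close>

lemma continuous_sesquilinear_bounded:
  assumes "continuous_sesquilinear b"
  obtains K where "0 \<le> K" "\<And>x y. cmod (b x y) \<le> K * norm x * norm y"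
proof -
  have b: "sesquilinear b" and "continuous_on UNIV (\<lambda>(x, y). b x y)"
    using assms unfolding continuous_sesquilinear_def by auto
  then have "isCont (\<lambda>(x, y). b x y) (0, 0)"
    by (simp add: continuous_on_eq_continuous_at)
  then obtain d where d: "d > 0"
    and dball: "\<And>p. dist p (0, 0) < d \<Longrightarrow> dist (case p of (x, y) \<Rightarrow> b x y) (b 0 0) < 1"
    unfolding continuous_at_eps_delta by (auto simp: dist_commute dest!: spec[of _ 1])
  have small: "cmod (b x y) \<le> 1" if "norm x \<le> d / 3" "norm y \<le> d / 3" for x y
  proof -
    have "norm (x, y) \<le> norm x + norm y"
      by (simp add: norm_prod_def sqrt_sum_squares_le_sum)
    also have "\<dots> < d" using that d by linarith
    finally have "dist (x, y) (0, 0) < d"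
      by (simp add: dist_norm flip: zero_prod_def)
    from dball[OF this] show ?thesis
      by (simp add: dist_norm sesquilinear_zero_left[OF b])
  qed
  have "cmod (b x y) \<le> (3 / d)\<^sup>2 * norm x * norm y" for x y
  proof (cases "x = 0 \<or> y = 0")
    case True
    then show ?thesis
      by (auto simp: sesquilinear_zero_left[OF b] sesquilinear_zero_right[OF b])
  next
    case False
    define r s where "r = d / (3 * norm x)" and "s = d / (3 * norm y)"
    have pos: "r > 0" "s > 0" using False d by (auto simp: r_def s_def)
    have "cmod (b (r *\<^sub>R x) (s *\<^sub>R y)) \<le> 1"
      using False d by (intro small) (auto simp: r_def s_def)
    then have "r * s * cmod (b x y) \<le> 1"
      using pos by (simp add: sesquilinear_scaleR[OF b] norm_mult)
    then have "cmod (b x y) \<le> 1 / (r * s)"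
      using pos by (simp add: field_simps)
    also have "1 / (r * s) = (3 / d)\<^sup>2 * norm x * norm y"
      using d by (simp add: r_def s_def power2_eq_square)
    finally show ?thesis .
  qed
  then show ?thesis by (intro that[of "(3 / d)\<^sup>2"]) auto
qed

text \<open>The set of admissible constants is closed, so its infimum is the least element that the
  definition of \<open>form_norm\<close> selects.\<close>

lemma form_norm_bound:
  assumes "continuous_sesquilinear b"
  shows form_norm_nonneg: "0 \<le> form_norm b"
    and form_le_form_norm: "cmod (b x y) \<le> form_norm b * norm x * norm y"
proof -
  obtain K where K: "0 \<le> K" "\<And>x y. cmod (b x y) \<le> K * norm x * norm y"
    using continuous_sesquilinear_bounded[OF assms] by blast
  define A where "A = {C. 0 \<le> C \<and> (\<forall>x y. cmod (b x y) \<le> C * norm x * norm y)}"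
  have "K \<in> A" unfolding A_def using K by simp
  have "A = {0..} \<inter> (\<Inter>x. \<Inter>y. {C. cmod (b x y) \<le> C * norm x * norm y})"
    unfolding A_def by auto
  moreover have "closed {C. cmod (b x y) \<le> C * norm x * norm y}" for x y
    by (intro closed_Collect_le continuous_intros)
  ultimately have "closed A" by (auto intro!: closed_Int closed_INT)
  moreover have "A \<noteq> {}" using \<open>K \<in> A\<close> by blast
  moreover have below: "bdd_below A"
    unfolding A_def by (intro bdd_belowI[of _ 0]) auto
  ultimately have Inf: "Inf A \<in> A" by (intro closed_contains_Inf)
  have "form_norm b = Inf A"
    unfolding form_norm_def
  proof (rule Least_equality)
    show "0 \<le> Inf A \<and> (\<forall>x y. cmod (b x y) \<le> Inf A * norm x * norm y)"
      using Inf unfolding A_def by simp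
    show "Inf A \<le> C" if "0 \<le> C \<and> (\<forall>x y. cmod (b x y) \<le> C * norm x * norm y)" for C
      using that below by (intro cInf_lower) (simp_all add: A_def)
  qed
  with Inf have *: "form_norm b \<in> A" by simp
  from * show "0 \<le> form_norm b" unfolding A_def by simp
  from * show "cmod (b x y) \<le> form_norm b * norm x * norm y" unfolding A_def by simp
qed

text \<open>The form vanishes at \<open>x - x'\<close> on all of \<open>S\<close>, so the supremum in the inf-sup condition at
  \<open>x - x'\<close> is zero.\<close>

lemma inf_sup_unique:
  assumes b: "sesquilinear b" and c: "c > 0"
    and inf_sup: "\<And>x. ennreal (c * norm x) \<le> sup_quotient (b x) S"
    and eq: "\<And>y. y \<in> S \<Longrightarrow> b x y = b x' y"
  shows "x = x'"
proof -
  have "c * norm (x - x') \<le> 0"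
    using inf_sup[of "x - x'"] eq
    by (auto simp: le_sup_quotient_iff sesquilinear_zero_right[OF b] sesquilinear_diff_left[OF b]
        dest: spec[of _ 0])
  with c show ?thesis by (simp add: mult_le_0_iff)
qed

section \<open>Complex inner products\<close>

lemma sesquilinear_cinner: "sesquilinear cinner"
proof -
  have "cinner x (y + z) = cinner x y + cinner x z" for x y z :: 'a
    by (metis cinner_add_left cinner_commute complex_cnj_add)
  moreover have "cinner x (c *\<^sub>C y) = cnj c * cinner x y" for x y :: 'a and c
    by (metis cinner_scaleC_left cinner_commute complex_cnj_mult)
  ultimately show ?thesis
    unfolding sesquilinear_def by (simp add: cinner_add_left cinner_scaleC_left)
qed

lemmas cinner_add_right = sesquilinear_add_right[OF sesquilinear_cinner]
  and cinner_scaleC_right = sesquilinear_scaleC_right[OF sesquilinear_cinner]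
  and cinner_diff_left = sesquilinear_diff_left[OF sesquilinear_cinner]

lemma cinner_zero_imp_zero:
  assumes "\<And>y. cinner x y = 0"
  shows "x = (0 :: 'a :: complex_hilbert)"
  using assms[of x] by (simp add: cinner_self)

lemma norm_add_scaleR_square:
  "(norm (x + t *\<^sub>R y))\<^sup>2 = (norm x)\<^sup>2 + 2 * t * Re (cinner x y) + t\<^sup>2 * (norm y)\<^sup>2"
proof -
  have "Re (cinner y x) = Re (cinner x y)"
    by (subst cinner_commute) simp
  then have "Re (cinner (x + t *\<^sub>R y) (x + t *\<^sub>R y))
    = Re (cinner x x) + 2 * t * Re (cinner x y) + t\<^sup>2 * Re (cinner y y)"
    by (simp add: cinner_add_left cinner_add_right scaleR_scaleC
        cinner_scaleC_left cinner_scaleC_right algebra_simps power2_eq_square)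
  then show ?thesis by (simp only: cinner_self Re_complex_of_real)
qed

lemma norm_scaleC: "norm (c *\<^sub>C x) = cmod c * norm x"
proof -
  have "complex_of_real ((norm (c *\<^sub>C x))\<^sup>2) = c * cnj c * of_real ((norm x)\<^sup>2)"
    by (simp only: cinner_self[symmetric] cinner_scaleC_left cinner_scaleC_right ac_simps)
  also have "\<dots> = of_real ((cmod c * norm x)\<^sup>2)"
    by (simp only: complex_norm_square[symmetric] of_real_mult power_mult_distrib)
  finally have "(norm (c *\<^sub>C x))\<^sup>2 = (cmod c * norm x)\<^sup>2" by (simp only: of_real_eq_iff)
  then show ?thesis by (rule power2_eq_imp_eq) simp_all
qed

lemma parallelogram:
  fixes x y :: "'a :: complex_hilbert"
  shows "(norm (x + y))\<^sup>2 + (norm (x - y))\<^sup>2 = 2 * (norm x)\<^sup>2 + 2 * (norm y)\<^sup>2"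
  using norm_add_scaleR_square[of x 1 y] norm_add_scaleR_square[of x "-1" y] by simp

text \<open>The substituted argument is \<open>- a / (q + 1)\<close>: it is opposite in sign to \<open>a\<close>, and the \<open>1\<close> admits
  \<open>q = 0\<close>.\<close>

lemma quadratic_nonneg_imp_linear_zero:
  fixes a q :: real
  assumes q: "0 \<le> q" and nonneg: "\<And>t. 0 \<le> 2 * t * a + t\<^sup>2 * q"
  shows "a = 0"
proof (rule ccontr)
  assume a: "a \<noteq> 0"
  define d where "d = q + 1"
  have d: "d > 0" "q = d - 1" using q by (simp_all add: d_def)
  have "0 \<le> 2 * (- a / d) * a + (- a / d)\<^sup>2 * q" by (rule nonneg)
  also have "\<dots> = - (a\<^sup>2 * (d + 1) / d\<^sup>2)"
    using d(1) unfolding d(2) by (simp add: field_simps power2_eq_square)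
  also have "\<dots> < 0" using a d by simp
  finally show False by simp
qed

text \<open>Multiplying \<open>x\<close> by the conjugate of \<open>w = \<langle>x, y\<rangle>\<close> gives a vector \<open>z\<close> whose inner product with \<open>y\<close>
  is the real number \<open>\<bar>w\<bar>\<^sup>2\<close>, so that expanding the norm of \<open>z - (\<bar>w\<bar>\<^sup>2 / \<parallel>y\<parallel>\<^sup>2) y\<close> takes real
  coefficients only.\<close>

lemma cinner_Cauchy_Schwarz: "cmod (cinner x y) \<le> norm x * norm y"
proof (cases "cinner x y = 0")
  case False
  define w where "w = cinner x y"
  define z where "z = cnj w *\<^sub>C x"
  have zy: "cinner z y = of_real ((cmod w)\<^sup>2)"
    unfolding z_def cinner_scaleC_left complex_norm_square by (simp add: w_def)
  have nz: "norm z = cmod w * norm x" by (simp add: z_def norm_scaleC)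
  have "y \<noteq> 0" using False sesquilinear_zero_right[OF sesquilinear_cinner, of x] by auto
  then have ny: "norm y > 0" by simp
  have "0 \<le> (norm (z + (- (cmod w)\<^sup>2 / (norm y)\<^sup>2) *\<^sub>R y))\<^sup>2" by simp
  also have "\<dots> = (cmod w * norm x)\<^sup>2 - (cmod w)^4 / (norm y)\<^sup>2"
    unfolding norm_add_scaleR_square nz zy using ny
    by (simp add: field_simps power2_eq_square power4_eq_xxxx)
  finally have "(cmod w)^4 \<le> (cmod w)\<^sup>2 * (norm x * norm y)\<^sup>2"
    using ny by (simp add: field_simps)
  then have "(cmod w)\<^sup>2 * (cmod w)\<^sup>2 \<le> (cmod w)\<^sup>2 * (norm x * norm y)\<^sup>2"
    by (simp only: power_add[symmetric] numeral_plus_numeral arith_simps)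
  then have "(cmod w)\<^sup>2 \<le> (norm x * norm y)\<^sup>2"
    by (rule mult_left_le_imp_le) (simp add: w_def False)
  then show ?thesis unfolding w_def by (rule power2_le_imp_le) simp
qed simp

section \<open>Well-posedness from an inf-sup condition\<close>

lemma antidualD:
  assumes "l \<in> antidual"
  shows antidual_add: "l (y + y') = l y + l y'"
    and antidual_scaleC: "l (c *\<^sub>C y) = cnj c * l y"
    and antidual_continuous: "continuous_on UNIV l"
  using assms unfolding antidual_def by auto

lemma antidual_scaleR: "l \<in> antidual \<Longrightarrow> l (r *\<^sub>R y) = of_real r * l y"
  by (simp add: scaleR_scaleC antidual_scaleC)

text \<open>A functional \<open>l\<close> is the restriction of the form \<open>(c, y) \<mapsto> c * l y\<close> on \<open>complex\<close> to \<open>c = 1\<close>,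
  so its bound is one of a form.\<close>

lemma antidual_bounded:
  assumes "l \<in> antidual"
  obtains K where "0 \<le> K" "\<And>y. cmod (l y) \<le> K * norm y"
proof -
  have "sesquilinear (\<lambda>c y. c * l y)"
    unfolding sesquilinear_def
    by (simp add: antidual_add[OF assms] antidual_scaleC[OF assms] scaleC_complex_def algebra_simps)
  moreover have "continuous_on UNIV (\<lambda>p :: complex \<times> 'a. fst p * l (snd p))"
    by (intro continuous_intros continuous_on_compose2[OF antidual_continuous[OF assms]]) auto
  ultimately have "continuous_sesquilinear (\<lambda>c y. c * l y)"
    unfolding continuous_sesquilinear_def by (simp add: case_prod_unfold)
  then obtain K where "0 \<le> K" "\<And>c y. cmod (c * l y) \<le> K * norm c * norm y"
    by (rule continuous_sesquilinear_bounded) blast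
  from this(1) this(2)[of 1] show ?thesis by (intro that) auto
qed

lemma sesquilinear_section_antidual:
  assumes "continuous_sesquilinear b"
  shows "b x \<in> antidual"
proof -
  have b: "sesquilinear b" and cont: "continuous_on UNIV (\<lambda>p. b (fst p) (snd p))"
    using assms by (auto simp: continuous_sesquilinear_def case_prod_unfold)
  have "continuous_on UNIV (\<lambda>y. (\<lambda>p. b (fst p) (snd p)) (x, y))"
    by (rule continuous_on_compose2[OF cont]) (auto intro!: continuous_intros)
  then show ?thesis
    unfolding antidual_def
    by (simp add: sesquilinear_add_right[OF b] sesquilinear_scaleC_right[OF b])
qed

text \<open>By the parallelogram law, the functional \<open>J x = \<parallel>T x\<parallel>\<^sup>2 - 2 Re (l x)\<close> at the midpoint of \<open>x\<close> and \<open>y\<close>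
  lies below its mean at \<open>x\<close> and \<open>y\<close> by \<open>\<parallel>T (x - y)\<parallel>\<^sup>2 / 4\<close>, which is at least \<open>c\<^sup>2 \<parallel>x - y\<parallel>\<^sup>2 / 4\<close>. Hence
  minimizing sequences are Cauchy sequences, \<open>J\<close> attains its infimum, and the normal equation is
  the vanishing of the first variation.\<close>

lemma normal_equation_solvable:
  fixes T :: "'a :: complex_hilbert \<Rightarrow> 'b :: complex_hilbert"
  assumes add: "\<And>x y. T (x + y) = T x + T y"
    and scale: "\<And>c x. T (c *\<^sub>C x) = c *\<^sub>C T x"
    and bounded: "\<And>x. norm (T x) \<le> K * norm x"
    and below: "\<And>x. c * norm x \<le> norm (T x)" and c: "c > 0"
    and l: "l \<in> antidual"
  obtains x where "\<And>z. cinner (T x) (T z) = l z"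
proof -
  define J where "J x = (norm (T x))\<^sup>2 - 2 * Re (l x)" for x
  have T_scaleR: "T (r *\<^sub>R x) = r *\<^sub>R T x" for r x
    by (simp add: scaleR_scaleC scale)
  have T: "bounded_linear T"
    by (rule bounded_linear_intro[where K = K])
      (simp_all add: add T_scaleR bounded mult.commute)
  have T_diff: "T (x - y) = T x - T y" for x y
    by (rule linear_diff[OF bounded_linear.linear[OF T]])
  obtain L where L: "0 \<le> L" "\<And>y. cmod (l y) \<le> L * norm y"
    using antidual_bounded[OF l] by blast
  \<comment> \<open>Completing the square in \<open>c * norm x\<close> bounds \<open>J\<close> from below.\<close>
  have J_below: "- (L / c)\<^sup>2 \<le> J x" for x
  proof -
    have "Re (l x) \<le> L * norm x" using L(2)[of x] complex_Re_le_cmod[of "l x"] by linarith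
    moreover have "(c * norm x)\<^sup>2 \<le> (norm (T x))\<^sup>2"
      using below[of x] c by (intro power_mono) auto
    moreover have "0 \<le> (c * norm x - L / c)\<^sup>2" by simp
    moreover have "(c * norm x - L / c)\<^sup>2 = (c * norm x)\<^sup>2 - 2 * (L * norm x) + (L / c)\<^sup>2"
      using c by (simp add: power2_diff)
    ultimately show ?thesis unfolding J_def by linarith
  qed
  define m where "m = Inf (range J)"
  have bdd: "bdd_below (range J)" using J_below by (intro bdd_belowI2)
  have m_le: "m \<le> J x" for x
    unfolding m_def by (rule cInf_lower[OF _ bdd]) simp
  have "\<exists>x. J x < m + 1 / real (Suc n)" for n
    using cInf_lessD[of "range J" "m + 1 / real (Suc n)"] by (auto simp: m_def)
  then obtain f where f: "\<And>n. J (f n) < m + 1 / real (Suc n)" by metis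
  have midpoint: "c\<^sup>2 * (norm (x - y))\<^sup>2 \<le> 2 * (J x - m) + 2 * (J y - m)" for x y
  proof -
    have "T ((1 / 2) *\<^sub>R (x + y)) = (1 / 2) *\<^sub>R (T x + T y)"
      and "Re (l ((1 / 2) *\<^sub>R (x + y))) = (Re (l x) + Re (l y)) / 2"
      by (simp_all add: T_scaleR add antidual_scaleR[OF l] antidual_add[OF l] del: scaleR_add_right)
    then have "4 * J ((1 / 2) *\<^sub>R (x + y)) = (norm (T x + T y))\<^sup>2 - 4 * Re (l x) - 4 * Re (l y)"
      by (simp add: J_def power_divide)
    moreover have "(c * norm (x - y))\<^sup>2 \<le> (norm (T x - T y))\<^sup>2"
      using below[of "x - y"] c unfolding T_diff by (intro power_mono) auto
    ultimately show ?thesis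
      using parallelogram[of "T x" "T y"] m_le[of "(1 / 2) *\<^sub>R (x + y)"]
      by (simp add: J_def power_mult_distrib)
  qed
  have "Cauchy f"
  proof (rule metric_CauchyI)
    fix e :: real assume e: "e > 0"
    have "c\<^sup>2 * e\<^sup>2 / 4 > 0" using c e by simp
    then obtain N where N: "1 / real (Suc N) < c\<^sup>2 * e\<^sup>2 / 4"
      using nat_approx_posE by blast
    have close: "4 * (J (f n) - m) < c\<^sup>2 * e\<^sup>2" if "n \<ge> N" for n
    proof -
      have "1 / real (Suc n) \<le> 1 / real (Suc N)" using that by (simp add: frac_le)
      with f[of n] N have "J (f n) - m < c\<^sup>2 * e\<^sup>2 / 4" by linarith
      then show ?thesis by simp
    qed
    show "\<exists>N. \<forall>i\<ge>N. \<forall>j\<ge>N. dist (f i) (f j) < e"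
    proof (intro exI allI impI)
      fix i j assume "N \<le> i" "N \<le> j"
      with midpoint[of "f i" "f j"] close[OF \<open>N \<le> i\<close>] close[OF \<open>N \<le> j\<close>]
      have "c\<^sup>2 * (norm (f i - f j))\<^sup>2 < c\<^sup>2 * e\<^sup>2" by linarith
      then have "(norm (f i - f j))\<^sup>2 < e\<^sup>2" using c by simp
      then show "dist (f i) (f j) < e"
        using e by (simp add: dist_norm power_less_imp_less_base)
    qed
  qed
  then obtain x where x: "f \<longlonglongrightarrow> x" using Cauchy_convergent_iff convergent_def by blast
  have "isCont l x"
    using antidual_continuous[OF l] by (simp add: continuous_on_eq_continuous_at)
  then have "(\<lambda>n. J (f n)) \<longlonglongrightarrow> J x"
    unfolding J_def
    by (intro tendsto_intros bounded_linear.tendsto[OF T] isCont_tendsto_compose[of x l] x)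
  moreover have "(\<lambda>n. m + 1 / real (Suc n)) \<longlonglongrightarrow> m + 0"
    by (intro tendsto_add tendsto_const LIMSEQ_Suc lim_1_over_n)
  ultimately have "J x \<le> m + 0"
    by (rule LIMSEQ_le) (use f less_imp_le in blast)
  with m_le have minimal: "J x \<le> J y" for y by (smt (verit))
  have Re: "Re (cinner (T x) (T z)) = Re (l z)" for z
  proof -
    have "0 \<le> 2 * t * (Re (cinner (T x) (T z)) - Re (l z)) + t\<^sup>2 * (norm (T z))\<^sup>2" for t
      using minimal[of "x + t *\<^sub>R z"]
      by (simp add: J_def add T_scaleR norm_add_scaleR_square antidual_add[OF l]
          antidual_scaleR[OF l] algebra_simps)
    then have "Re (cinner (T x) (T z)) - Re (l z) = 0"
      by (intro quadratic_nonneg_imp_linear_zero[of "(norm (T z))\<^sup>2"]) auto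
    then show ?thesis by simp
  qed
  show ?thesis
  proof
    fix z
    \<comment> \<open>Imaginary parts are real parts at the rotated vector.\<close>
    have "Im (cinner (T x) (T z)) = Im (l z)"
      using Re[of "\<i> *\<^sub>C z"] by (simp add: scale cinner_scaleC_right antidual_scaleC[OF l])
    with Re[of z] show "cinner (T x) (T z) = l z" by (rule complex_eqI)
  qed
qed

corollary Riesz_representation:
  assumes "l \<in> antidual"
  obtains u where "\<And>y. cinner u y = l y"
  using normal_equation_solvable[of "\<lambda>x. x" 1 1 l] assms by auto

text \<open>The bounded operator \<open>B\<close> with \<open>b x y = \<langle>B x, y\<rangle>\<close> turns the inf-sup condition into the lower
  bound \<open>c \<parallel>x\<parallel> \<le> \<parallel>B x\<parallel>\<close>. Solving \<open>\<langle>B x, B z\<rangle> = \<langle>u, B z\<rangle>\<close> projects the representative \<open>u\<close> of \<open>l\<close> onto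
  the range of \<open>B\<close>; the remainder \<open>u - B x\<close> is annihilated by \<open>b\<close>.\<close>

theorem inf_sup_wellposed:
  fixes b :: "'a :: complex_hilbert \<Rightarrow> 'b :: complex_hilbert \<Rightarrow> complex"
  assumes cont: "continuous_sesquilinear b" and c: "c > 0"
    and inf_sup: "\<And>x. ennreal (c * norm x) \<le> sup_quotient (b x) UNIV"
    and nondegenerate: "\<And>y. (\<And>x. b x y = 0) \<Longrightarrow> y = 0"
    and l: "l \<in> antidual"
  shows "\<exists>!x. \<forall>y. b x y = l y"
proof -
  have b: "sesquilinear b" using cont by (simp add: continuous_sesquilinear_def)
  obtain K where K: "0 \<le> K" "\<And>x y. cmod (b x y) \<le> K * norm x * norm y"
    using continuous_sesquilinear_bounded[OF cont] by blast
  have "\<exists>v. \<forall>y. cinner v y = b x y" for x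
    using Riesz_representation[OF sesquilinear_section_antidual[OF cont]] by metis
  then obtain B where B: "\<And>x y. cinner (B x) y = b x y" by metis
  have B_unique: "v = B x" if "\<And>y. cinner v y = b x y" for v x
    using cinner_zero_imp_zero[of "v - B x"] that by (simp add: cinner_diff_left B)
  have B_add: "B (x + x') = B x + B x'" for x x'
    by (rule B_unique[symmetric]) (simp add: cinner_add_left B sesquilinear_add_left[OF b])
  have B_scale: "B (a *\<^sub>C x) = a *\<^sub>C B x" for a x
    by (rule B_unique[symmetric]) (simp add: cinner_scaleC_left B sesquilinear_scaleC_left[OF b])
  have B_bounded: "norm (B x) \<le> K * norm x" for x
  proof (cases "B x = 0")
    case False
    have "cmod (cinner (B x) (B x)) \<le> K * norm x * norm (B x)"
      unfolding B by (rule K(2))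
    then have "norm (B x) * norm (B x) \<le> K * norm x * norm (B x)"
      by (simp add: cinner_self power2_eq_square norm_mult)
    with False show ?thesis by simp
  qed (simp add: K(1))
  have B_below: "c * norm x \<le> norm (B x)" for x
    using inf_sup[of x] cinner_Cauchy_Schwarz[of "B x"]
    by (simp add: le_sup_quotient_iff sesquilinear_zero_right[OF b] B)
  obtain u where u: "\<And>y. cinner u y = l y" using Riesz_representation[OF l] by blast
  have "bounded_linear B"
    by (rule bounded_linear_intro[where K = K])
      (simp_all add: B_add B_scale scaleR_scaleC B_bounded mult.commute)
  then have "continuous_on UNIV (\<lambda>z. l (B z))"
    by (intro continuous_on_compose2[OF antidual_continuous[OF l]] linear_continuous_on) auto
  then have "(\<lambda>z. l (B z)) \<in> antidual"
    by (simp add: antidual_def B_add B_scale antidual_add[OF l] antidual_scaleC[OF l])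
  then obtain x where x: "\<And>z. cinner (B x) (B z) = l (B z)"
    using normal_equation_solvable[OF B_add B_scale B_bounded B_below c] by blast
  have "b z (u - B x) = 0" for z
  proof -
    have "cinner (u - B x) (B z) = 0" by (simp add: cinner_diff_left u x)
    then show ?thesis by (metis B cinner_commute complex_cnj_zero)
  qed
  then have "u - B x = 0" by (rule nondegenerate)
  then have "\<forall>y. b x y = l y" using u B by simp
  moreover have "x' = x" if "\<forall>y. b x' y = l y" for x'
    by (rule inf_sup_unique[OF b c inf_sup]) (simp add: that \<open>\<forall>y. b x y = l y\<close>)
  ultimately show ?thesis by blast
qed

section \<open>The product form\<close>

lemma continuous_sesquilinear_product_form:
  assumes "continuous_sesquilinear b0" "continuous_sesquilinear bh"
  shows "continuous_sesquilinear (product_form b0 bh)"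
proof -
  have s: "sesquilinear b0" "sesquilinear bh"
    and cont0: "continuous_on UNIV (\<lambda>p. b0 (fst p) (snd p))"
    and conth: "continuous_on UNIV (\<lambda>p. bh (fst p) (snd p))"
    using assms by (auto simp: continuous_sesquilinear_def case_prod_unfold)
  have "sesquilinear (product_form b0 bh)"
    unfolding sesquilinear_def product_form_def
    by (auto simp: scaleC_prod_def sesquilinearD[OF s(1)] sesquilinearD[OF s(2)] algebra_simps)
  moreover have
    "continuous_on UNIV (\<lambda>q. (\<lambda>p. b0 (fst p) (snd p)) (fst (fst q), snd q)
      + (\<lambda>p. bh (fst p) (snd p)) (snd (fst q), snd q))"
    by (intro continuous_on_add continuous_on_compose2[OF cont0] continuous_on_compose2[OF conth]
        continuous_intros) auto
  ultimately show ?thesis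
    unfolding continuous_sesquilinear_def product_form_def by (simp add: case_prod_unfold)
qed

text \<open>The tests are nested: \<open>Y0\<close> sees only \<open>x\<close>, and the resulting bound on \<open>x\<close> makes \<open>b0 x\<close> a
  controlled perturbation when \<open>xh\<close> is tested on all of \<open>Y\<close>. The constant is what the two bounds
  give in the Euclidean product norm.\<close>

lemma product_form_inf_sup:
  fixes b0 :: "'x0 :: complex_hilbert \<Rightarrow> 'y :: complex_hilbert \<Rightarrow> complex"
    and bh :: "'xh :: complex_hilbert \<Rightarrow> 'y \<Rightarrow> complex"
  assumes b0: "continuous_sesquilinear b0" and bh: "sesquilinear bh"
    and c: "c0 > 0" "ch > 0" "c1 > 0"
    and inf_sup0: "\<And>x. ennreal (c0 * norm x) \<le> sup_quotient (b0 x) {y. \<forall>xh. bh xh y = 0}"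
    and inf_suph: "\<And>xh. ennreal (ch * norm xh) \<le> sup_quotient (bh xh) UNIV"
    and c1: "1 / c1\<^sup>2 = 1 / c0\<^sup>2 + 1 / ch\<^sup>2 * (form_norm b0 / c0 + 1)\<^sup>2"
  shows "ennreal (c1 * norm (x, xh)) \<le> sup_quotient (product_form b0 bh (x, xh)) UNIV"
proof -
  have b0s: "sesquilinear b0" using b0 by (simp add: continuous_sesquilinear_def)
  note zero = sesquilinear_zero_right[OF b0s] sesquilinear_zero_right[OF bh]
  define N where "N = form_norm b0"
  have N: "0 \<le> N" "\<And>x y. cmod (b0 x y) \<le> N * norm x * norm y"
    unfolding N_def by (rule form_norm_nonneg[OF b0] form_le_form_norm[OF b0])+
  have "c1 * norm (x, xh) \<le> M"
    if M: "0 \<le> M" and bound: "\<And>y. cmod (b0 x y + bh xh y) \<le> M * norm y" for M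
  proof -
    have "cmod (b0 x y) \<le> M * norm y" if "\<forall>xh. bh xh y = 0" for y
      using bound[of y] that by simp
    then have x: "c0 * norm x \<le> M"
      using inf_sup0[of x] M by (simp add: le_sup_quotient_iff zero)
    have "cmod (bh xh y) \<le> (M + N * norm x) * norm y" for y
    proof -
      have "cmod (bh xh y) \<le> cmod (b0 x y + bh xh y) + cmod (b0 x y)"
        using norm_triangle_ineq4[of "b0 x y + bh xh y" "b0 x y"] by simp
      also have "\<dots> \<le> M * norm y + N * norm x * norm y" by (intro add_mono bound N)
      finally show ?thesis by (simp add: algebra_simps)
    qed
    then have "ch * norm xh \<le> M + N * norm x"
      using inf_suph[of xh] M N by (simp add: le_sup_quotient_iff zero)
    also have "\<dots> \<le> M + N * (M / c0)"
      using x c N by (intro add_left_mono mult_left_mono) (simp_all add: field_simps)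
    also have "\<dots> = M * (N / c0 + 1)" by (simp add: algebra_simps)
    finally have "norm xh \<le> M * (N / c0 + 1) / ch" using c by (simp add: field_simps)
    then have "(norm xh)\<^sup>2 \<le> (M * (N / c0 + 1) / ch)\<^sup>2" by (intro power_mono) auto
    moreover have "(norm x)\<^sup>2 \<le> (M / c0)\<^sup>2"
      using x c by (intro power_mono) (simp_all add: field_simps)
    ultimately have "(norm (x, xh))\<^sup>2 \<le> (M / c0)\<^sup>2 + (M * (N / c0 + 1) / ch)\<^sup>2"
      by (simp add: norm_prod_def)
    also have "\<dots> = M\<^sup>2 * (1 / c1\<^sup>2)"
      unfolding c1 N_def power_divide power_mult_distrib by (subst distrib_left) simp
    finally have "(c1 * norm (x, xh))\<^sup>2 \<le> M\<^sup>2"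
      using c by (simp add: field_simps power_mult_distrib)
    then show ?thesis using M by (rule power2_le_imp_le)
  qed
  then show ?thesis by (simp add: le_sup_quotient_iff product_form_def zero)
qed

lemma product_form_annihilator:
  assumes "sesquilinear b0" "sesquilinear bh"
  shows "(\<forall>x xh. product_form b0 bh (x, xh) y = 0) \<longleftrightarrow> (\<forall>xh. bh xh y = 0) \<and> (\<forall>x. b0 x y = 0)"
  (is "?b \<longleftrightarrow> ?annihilated")
proof
  assume b: ?b
  show ?annihilated
  proof (intro conjI allI)
    show "bh xh y = 0" for xh
      using b[rule_format, of 0 xh] by (simp add: product_form_def sesquilinear_zero_left[OF assms(1)])
    show "b0 x y = 0" for x
      using b[rule_format, of x 0] by (simp add: product_form_def sesquilinear_zero_left[OF assms(2)])
  qed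
qed (simp add: product_form_def)

theorem theorem3p1:
  fixes b0 :: "'x0 :: complex_hilbert \<Rightarrow> 'y :: complex_hilbert \<Rightarrow> complex"
    and bh :: "'xh :: complex_hilbert \<Rightarrow> 'y \<Rightarrow> complex"
    and b :: "'x0 \<times> 'xh \<Rightarrow> 'y \<Rightarrow> complex"
    and Y0 Z0 Z :: "'y set"
    and c0 ch :: real
  assumes "complex_vector.subspace Y0" and "closed Y0"
    and "continuous_sesquilinear b0"
    and "continuous_sesquilinear bh"
    and "b = product_form b0 bh"
    and "c0 > 0"
    and "\<And>x. ennreal (c0 * norm x) \<le> sup_quotient (b0 x) Y0"
    and "Y0 = {y. \<forall>xh. bh xh y = 0}"
    and "ch > 0"
    and "\<And>xh. ennreal (ch * norm xh) \<le> sup_quotient (bh xh) UNIV"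
    and "Z0 = {y \<in> Y0. \<forall>x. b0 x y = 0}"
    and "Z = {y. \<forall>x xh. b (x, xh) y = 0}"
  shows "(\<exists>c1 > 0. 1 / c1\<^sup>2 = 1 / c0\<^sup>2 + 1 / ch\<^sup>2 * (form_norm b0 / c0 + 1)\<^sup>2 \<and>
        (\<forall>x xh. ennreal (c1 * norm (x, xh)) \<le> sup_quotient (b (x, xh)) UNIV))
    \<and> Z = Z0
    \<and> (Z0 = {0} \<longrightarrow> (\<forall>l \<in> antidual.
        (\<exists>!p. \<forall>y. b p y = l y) \<and>
        (\<exists>!x. \<forall>y \<in> Y0. b0 x y = l y) \<and>
        (\<forall>x xh x0. (\<forall>y. b (x, xh) y = l y) \<longrightarrow> (\<forall>y \<in> Y0. b0 x0 y = l y) \<longrightarrow> x = x0)))"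
proof (intro conjI impI ballI)
  note Y0_eq = \<open>Y0 = {y. \<forall>xh. bh xh y = 0}\<close>
  note b_eq = \<open>b = product_form b0 bh\<close>
  note cont0 = \<open>continuous_sesquilinear b0\<close>
  note conth = \<open>continuous_sesquilinear bh\<close>
  have s0: "sesquilinear b0" and sh: "sesquilinear bh"
    using cont0 conth by (simp_all add: continuous_sesquilinear_def)
  have contb: "continuous_sesquilinear b"
    unfolding b_eq by (rule continuous_sesquilinear_product_form[OF cont0 conth])
  define s where "s = 1 / c0\<^sup>2 + 1 / ch\<^sup>2 * (form_norm b0 / c0 + 1)\<^sup>2"
  define c1 where "c1 = 1 / sqrt s"
  have s: "s > 0" using \<open>c0 > 0\<close> by (simp add: s_def add_pos_nonneg)
  then have c1: "c1 > 0" and c1_sq: "1 / c1\<^sup>2 = s"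
    by (simp_all add: c1_def power_divide)
  have inf_sup: "ennreal (c1 * norm (x, xh)) \<le> sup_quotient (b (x, xh)) UNIV" for x xh
    unfolding b_eq
    by (rule product_form_inf_sup[OF cont0 sh \<open>c0 > 0\<close> \<open>ch > 0\<close> c1
          assms(7)[unfolded Y0_eq] assms(10) c1_sq[unfolded s_def]])
  then show "\<exists>c1>0. 1 / c1\<^sup>2 = 1 / c0\<^sup>2 + 1 / ch\<^sup>2 * (form_norm b0 / c0 + 1)\<^sup>2 \<and>
      (\<forall>x xh. ennreal (c1 * norm (x, xh)) \<le> sup_quotient (b (x, xh)) UNIV)"
    using c1 c1_sq unfolding s_def by blast
  show Z: "Z = Z0"
    unfolding assms(11,12) Y0_eq b_eq product_form_annihilator[OF s0 sh] by auto
  fix l :: "'y \<Rightarrow> complex"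
  assume Z0: "Z0 = {0}" and l: "l \<in> antidual"
  have nondegenerate: "y = 0" if "\<And>p. b p y = 0" for y
  proof -
    have "y \<in> Z" using that by (simp add: assms(12))
    then show ?thesis by (simp add: Z Z0)
  qed
  have inf_sup': "ennreal (c1 * norm p) \<le> sup_quotient (b p) UNIV" for p
    using inf_sup[of "fst p" "snd p"] by simp
  show ex1: "\<exists>!p. \<forall>y. b p y = l y"
    by (rule inf_sup_wellposed[OF contb c1 inf_sup' nondegenerate l])
  have component: "\<forall>y\<in>Y0. b0 x y = l y" if "\<forall>y. b (x, xh) y = l y" for x xh
  proof
    fix y assume "y \<in> Y0"
    then show "b0 x y = l y"
      using that[rule_format, of y] by (simp add: b_eq product_form_def Y0_eq)
  qed
  have unique: "x = x0" if "\<forall>y\<in>Y0. b0 x y = l y" "\<forall>y\<in>Y0. b0 x0 y = l y" for x x0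
    by (rule inf_sup_unique[OF s0 \<open>c0 > 0\<close> assms(7)]) (simp add: that)
  from ex1 obtain x xh where "\<forall>y. b (x, xh) y = l y" by (metis surj_pair)
  then show "\<exists>!x. \<forall>y\<in>Y0. b0 x y = l y"
    using component unique by blast
  show "\<forall>x xh x0. (\<forall>y. b (x, xh) y = l y) \<longrightarrow> (\<forall>y\<in>Y0. b0 x0 y = l y) \<longrightarrow> x = x0"
    using component unique by blast
qed

end
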